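(* Let $S$ be an Ore semigroup, let $\lambda$ be a circle-valued multiplier on $S$, and let $\{V_s:s\in S\}$ be an isometric $\lambda$-representation of $S$ on a Hilbert space $H$. Then there exists a unitary $\lambda$-representation $\{U_s:s\in S\}$ of $S$ on a Hilbert space $\mathcal H$ containing a copy of $H$ such that (i) for every $s\in S$, $U_s$ leaves $H$ invariant and $U_s|_H=V_s$; and (ii) $\bigcup_{s\in S}U_s^*H$ is dense in $\mathcal H$.
   Context: An Ore semigroup is a (discrete) cancellative semigroup $S$ such that $Ss\cap St\neq\emptyset$ for all $s,t\in S$. A circle-valued multiplier on $S$ is a function $\lambda:S\times S\to\mathbb T$ with $\lambda(r,s)\lambda(rs,t)=\lambda(r,st)\lambda(s,t)$ for all $r,s,t\in S$. An isometric $\lambda$-representation of $S$ on $H$ is a family $\{V_s:s\in S\}$ of isometries on $H$ with $V_sV_t=\lambda(s,t)V_{st}$ for all $s,t\in S$; it is a unitary $\lambda$-representation if every operator in the family is unitary. "Containing a copy of $H$" means that $H$ is identified with a closed subspace of $\mathcal H$ via an isometric linear embedding. *)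

theory Defs
  imports "HOL-Analysis.Analysis" "HOL-Algebra.Module"
begin

section \<open>Ore semigroups and multipliers\<close>

class ore_semigroup = semigroup_mult +
  assumes ore_left_cancel: "a * b = a * c \<Longrightarrow> b = c"
    and ore_right_cancel: "b * a = c * a \<Longrightarrow> b = c"
    and ore: "range (\<lambda>x. x * s) \<inter> range (\<lambda>x. x * t) \<noteq> {}"

definition circle_multiplier :: "('s::semigroup_mult \<Rightarrow> 's \<Rightarrow> complex) \<Rightarrow> bool" where
  "circle_multiplier \<omega> \<longleftrightarrow>
     (\<forall>s t. norm (\<omega> s t) = 1) \<and>
     (\<forall>r s t. \<omega> r s * \<omega> (r * s) t = \<omega> r (s * t) * \<omega> s t)"

section \<open>Complex Hilbert spaces with explicit carriers\<close>

text \<open>A Hilbert space whose construction depends on term variables cannot be a HOL type, so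
  Hilbert spaces are structures with a carrier: modules over the field of complex numbers with an
  inner product. As for every module record, the inherited fields \<open>mult\<close> and \<open>one\<close>
  of the space itself carry no meaning. An existence statement has to name the type of the vectors.
  For a space \<open>K\<close> containing \<open>H\<close> in which the union of the spaces \<open>U s\<^sup>* H\<close> is dense,
  functions from the semigroup to \<open>H\<close> are enough: a vector \<open>x\<close> of \<open>K\<close> is determined by its
  coordinates \<open>P (U s x)\<close>, with \<open>P\<close> the orthogonal projection onto \<open>H\<close>.\<close>

definition complex_ring :: "complex ring" where
  "complex_ring = \<lparr>carrier = UNIV, mult = (*), one = 1, zero = 0, add = (+)\<rparr>"

record 'v cinner_space = "(complex, 'v) module" +
  cinner :: "'v \<Rightarrow> 'v \<Rightarrow> complex"

definition hnorm :: "'v cinner_space \<Rightarrow> 'v \<Rightarrow> real" where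
  "hnorm H x = sqrt (Re (cinner H x x))"

text \<open>The value outside the carrier is irrelevant, but \<open>Metric_space\<close> requires the
  distance to be symmetric and nonnegative on the whole type.\<close>

definition hdist :: "'v cinner_space \<Rightarrow> 'v \<Rightarrow> 'v \<Rightarrow> real" where
  "hdist H x y =
     (if x \<in> carrier H \<and> y \<in> carrier H then hnorm H (x \<ominus>\<^bsub>H\<^esub> y) else 0)"

text \<open>The inner product is linear in its first argument.\<close>

locale complex_inner_space = module complex_ring H for H :: "'v cinner_space" (structure) +
  assumes cinner_commute:
      "\<lbrakk>x \<in> carrier H; y \<in> carrier H\<rbrakk> \<Longrightarrow> cinner H x y = cnj (cinner H y x)"
    and cinner_add_left:
      "\<lbrakk>x \<in> carrier H; y \<in> carrier H; z \<in> carrier H\<rbrakk> \<Longrightarrow>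
        cinner H (x \<oplus> y) z = cinner H x z + cinner H y z"
    and cinner_smult_left:
      "\<lbrakk>x \<in> carrier H; y \<in> carrier H\<rbrakk> \<Longrightarrow> cinner H (c \<odot> x) y = c * cinner H x y"
    and cinner_ge_zero: "x \<in> carrier H \<Longrightarrow> 0 \<le> Re (cinner H x x)"
    and cinner_eq_zeroD: "\<lbrakk>x \<in> carrier H; cinner H x x = 0\<rbrakk> \<Longrightarrow> x = \<zero>"
begin

lemma cinner_add_right:
  assumes "x \<in> carrier H" "y \<in> carrier H" "z \<in> carrier H"
  shows "cinner H x (y \<oplus> z) = cinner H x y + cinner H x z"
  using assms cinner_commute[of x "y \<oplus> z"] cinner_commute[of x y] cinner_commute[of x z]
  by (simp add: cinner_add_left)

lemma cinner_smult_right: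
  assumes "x \<in> carrier H" "y \<in> carrier H"
  shows "cinner H x (c \<odot> y) = cnj c * cinner H x y"
proof -
  have "c \<odot> y \<in> carrier H" using assms by (simp add: complex_ring_def)
  then show ?thesis
    using assms cinner_commute[of x "c \<odot> y"] cinner_commute[of x y]
    by (simp add: cinner_smult_left)
qed

lemma smult_in_carrier [simp]: "x \<in> carrier H \<Longrightarrow> c \<odot> x \<in> carrier H"
  by (simp add: complex_ring_def)

lemma diff_eq_zero_iff:
  assumes "x \<in> carrier H" "y \<in> carrier H" shows "x \<ominus> y = \<zero> \<longleftrightarrow> x = y"
proof
  assume "x \<ominus> y = \<zero>"
  moreover have "x = (x \<ominus> y) \<oplus> y"
    using assms by (simp add: a_minus_def M.a_assoc M.l_neg)
  ultimately show "x = y" using assms by simp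
qed (use assms in \<open>simp add: a_minus_def M.r_neg\<close>)

lemma cinner_zero_left [simp]: "y \<in> carrier H \<Longrightarrow> cinner H \<zero> y = 0"
  using cinner_add_left[of \<zero> \<zero> y] by simp

lemma cinner_minus_left:
  assumes "x \<in> carrier H" "y \<in> carrier H" shows "cinner H (\<ominus> x) y = - cinner H x y"
proof -
  have "cinner H (\<ominus> x \<oplus> x) y = 0" using assms by (simp add: M.l_neg)
  then show ?thesis using assms by (simp add: cinner_add_left eq_neg_iff_add_eq_0)
qed

lemma cinner_minus_right:
  assumes "x \<in> carrier H" "y \<in> carrier H" shows "cinner H y (\<ominus> x) = - cinner H y x"
  using assms cinner_commute[of y "\<ominus> x"] cinner_commute[of y x] by (simp add: cinner_minus_left)

lemma cinner_self_real: "x \<in> carrier H \<Longrightarrow> cinner H x x = of_real (Re (cinner H x x))"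
  using cinner_commute[of x x] by (simp add: complex_eq_iff)

lemma hnorm_sq: "x \<in> carrier H \<Longrightarrow> (hnorm H x)\<^sup>2 = Re (cinner H x x)"
  by (simp add: hnorm_def cinner_ge_zero)

lemma hnorm_ge_zero: "x \<in> carrier H \<Longrightarrow> 0 \<le> hnorm H x"
  by (simp add: hnorm_def cinner_ge_zero)

lemma hnorm_eq_zero: "x \<in> carrier H \<Longrightarrow> hnorm H x = 0 \<longleftrightarrow> x = \<zero>"
  using cinner_self_real[of x] cinner_eq_zeroD[of x] by (auto simp: hnorm_def)

lemma hnorm_minus: "x \<in> carrier H \<Longrightarrow> hnorm H (\<ominus> x) = hnorm H x"
  by (simp add: hnorm_def cinner_minus_left cinner_minus_right)

lemma Cauchy_Schwarz:
  assumes x: "x \<in> carrier H" and y: "y \<in> carrier H"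
  shows "norm (cinner H x y) \<le> hnorm H x * hnorm H y"
proof (cases "y = \<zero>")
  case True
  then show ?thesis
    using x cinner_commute[of x \<zero>] by (simp add: hnorm_ge_zero hnorm_eq_zero)
next
  case False
  define q where "q = Re (cinner H y y)"
  have q: "q > 0" "cinner H y y = of_real q"
    using False y hnorm_eq_zero[of y] cinner_ge_zero[of y] cinner_self_real[of y]
    by (auto simp: q_def hnorm_def less_le)
  define a where "a = cinner H x y"
  define c where "c = - (a / of_real q)"
  have yx: "cinner H y x = cnj a" using x y cinner_commute[of y x] by (simp add: a_def)
  have "cinner H (x \<oplus> c \<odot> y) (x \<oplus> c \<odot> y)
      = cinner H x x + cnj c * a + c * (cnj a + cnj c * of_real q)"
    using x y by (simp add: cinner_add_left cinner_add_right cinner_smult_left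
        cinner_smult_right yx q(2) a_def[symmetric] algebra_simps)
  also have "cnj a + cnj c * of_real q = 0" using q(1) by (simp add: c_def)
  also have "cnj c * a = - of_real ((norm a)\<^sup>2 / q)"
    by (simp add: c_def complex_norm_square mult.commute del: of_real_power)
  finally have "0 \<le> Re (cinner H x x) - (norm a)\<^sup>2 / q"
    using cinner_ge_zero[of "x \<oplus> c \<odot> y"] x y by simp
  then have "(norm a)\<^sup>2 \<le> (hnorm H x * hnorm H y)\<^sup>2"
    using q(1) x y by (simp add: power_mult_distrib hnorm_sq q_def field_simps)
  then show ?thesis
    unfolding a_def[symmetric]
    by (rule power2_le_imp_le) (simp add: x y hnorm_ge_zero)
qed

lemma hnorm_triangle:
  assumes x: "x \<in> carrier H" and y: "y \<in> carrier H"
  shows "hnorm H (x \<oplus> y) \<le> hnorm H x + hnorm H y"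
proof (rule power2_le_imp_le)
  have yx: "Re (cinner H y x) = Re (cinner H x y)" using x y cinner_commute[of y x] by simp
  have "(hnorm H (x \<oplus> y))\<^sup>2 = (hnorm H x)\<^sup>2 + (hnorm H y)\<^sup>2 + 2 * Re (cinner H x y)"
    using x y by (simp add: hnorm_sq cinner_add_left cinner_add_right yx)
  also have "Re (cinner H x y) \<le> hnorm H x * hnorm H y"
    using Cauchy_Schwarz[OF x y] complex_Re_le_cmod[of "cinner H x y"] by linarith
  finally show "(hnorm H (x \<oplus> y))\<^sup>2 \<le> (hnorm H x + hnorm H y)\<^sup>2"
    by (simp add: power2_sum)
qed (simp add: x y hnorm_ge_zero)

end

sublocale complex_inner_space \<subseteq> Metric_space "carrier H" "hdist H"
proof
  show "0 \<le> hdist H x y" for x y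
    by (simp add: hdist_def hnorm_ge_zero)
  show "hdist H x y = hdist H y x" for x y
    using hnorm_minus[of "x \<ominus> y"]
    by (auto simp: hdist_def a_minus_def M.minus_add M.a_comm)
  show "hdist H x y = 0 \<longleftrightarrow> x = y" if "x \<in> carrier H" "y \<in> carrier H" for x y
    using that hnorm_eq_zero[of "x \<ominus> y"] by (simp add: hdist_def diff_eq_zero_iff)
  show "hdist H x z \<le> hdist H x y + hdist H y z"
    if "x \<in> carrier H" "y \<in> carrier H" "z \<in> carrier H" for x y z
  proof -
    have "x \<ominus> z = (x \<ominus> y) \<oplus> (y \<ominus> z)"
      using that by (simp add: a_minus_def M.a_assoc M.r_neg2 M.r_neg1)
    then show ?thesis
      using that hnorm_triangle[of "x \<ominus> y" "y \<ominus> z"] by (simp add: hdist_def)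
  qed
qed

locale complex_hilbert_space = complex_inner_space +
  assumes complete: "mcomplete"

section \<open>Operators\<close>

text \<open>Operators are functions on the whole type of which only the restriction to the carrier
  matters.\<close>

definition linear_op :: "'v cinner_space \<Rightarrow> 'w cinner_space \<Rightarrow> ('v \<Rightarrow> 'w) \<Rightarrow> bool" where
  "linear_op H K T \<longleftrightarrow>
     T \<in> carrier H \<rightarrow> carrier K \<and>
     (\<forall>x\<in>carrier H. \<forall>y\<in>carrier H. T (x \<oplus>\<^bsub>H\<^esub> y) = T x \<oplus>\<^bsub>K\<^esub> T y) \<and>
     (\<forall>c. \<forall>x\<in>carrier H. T (c \<odot>\<^bsub>H\<^esub> x) = c \<odot>\<^bsub>K\<^esub> T x)"

definition bounded_op :: "'v cinner_space \<Rightarrow> 'w cinner_space \<Rightarrow> ('v \<Rightarrow> 'w) \<Rightarrow> bool" where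
  "bounded_op H K T \<longleftrightarrow>
     linear_op H K T \<and> (\<exists>C. \<forall>x\<in>carrier H. hnorm K (T x) \<le> C * hnorm H x)"

definition isometry_op :: "'v cinner_space \<Rightarrow> 'w cinner_space \<Rightarrow> ('v \<Rightarrow> 'w) \<Rightarrow> bool" where
  "isometry_op H K T \<longleftrightarrow>
     linear_op H K T \<and> (\<forall>x\<in>carrier H. hnorm K (T x) = hnorm H x)"

text \<open>For bounded \<open>T\<close> on a Hilbert space the described vector exists by the Riesz
  representation theorem.\<close>

definition adjoint_op :: "'v cinner_space \<Rightarrow> ('v \<Rightarrow> 'v) \<Rightarrow> 'v \<Rightarrow> 'v" where
  "adjoint_op H T y =
     (THE z. z \<in> carrier H \<and> (\<forall>x\<in>carrier H. cinner H (T x) y = cinner H x z))"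

lemma (in complex_inner_space) adjoint_op_eqI:
  assumes z: "z \<in> carrier H"
    and eq: "\<And>x. x \<in> carrier H \<Longrightarrow> cinner H (T x) y = cinner H x z"
  shows "adjoint_op H T y = z"
  unfolding adjoint_op_def
proof (rule the_equality)
  fix w assume w: "w \<in> carrier H \<and> (\<forall>x\<in>carrier H. cinner H (T x) y = cinner H x w)"
  have "cinner H (w \<ominus> z) (w \<ominus> z) = 0"
    using w z eq[of "w \<ominus> z"] by (simp add: a_minus_def cinner_add_right cinner_minus_right)
  then have "w \<ominus> z = \<zero>" using w z by (intro cinner_eq_zeroD) auto
  then show "w = z" using w z by (simp add: diff_eq_zero_iff)
qed (use assms in auto)

definition unitary_op :: "'v cinner_space \<Rightarrow> ('v \<Rightarrow> 'v) \<Rightarrow> bool" where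
  "unitary_op H T \<longleftrightarrow>
     bounded_op H H T \<and>
     (\<forall>x\<in>carrier H. adjoint_op H T (T x) = x \<and> T (adjoint_op H T x) = x)"

section \<open>Twisted representations\<close>

definition isometric_rep ::
    "'v cinner_space \<Rightarrow> ('s::semigroup_mult \<Rightarrow> 's \<Rightarrow> complex) \<Rightarrow> ('s \<Rightarrow> 'v \<Rightarrow> 'v) \<Rightarrow> bool" where
  "isometric_rep H \<omega> V \<longleftrightarrow>
     (\<forall>s. isometry_op H H (V s)) \<and>
     (\<forall>s t. \<forall>x\<in>carrier H. V s (V t x) = \<omega> s t \<odot>\<^bsub>H\<^esub> V (s * t) x)"

definition unitary_rep ::
    "'v cinner_space \<Rightarrow> ('s::semigroup_mult \<Rightarrow> 's \<Rightarrow> complex) \<Rightarrow> ('s \<Rightarrow> 'v \<Rightarrow> 'v) \<Rightarrow> bool" where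
  "unitary_rep H \<omega> U \<longleftrightarrow> isometric_rep H \<omega> U \<and> (\<forall>s. unitary_op H (U s))"

end

theory Submission
  imports Defs
begin

text \<open>If a unitary dilation \<open>U\<close> exists and \<open>P\<close> is the projection onto \<open>H\<close>, then the coordinates
  \<open>f s = P (U s x)\<close> of a vector \<open>x\<close> satisfy \<open>f s = \<omega> r s (V r)\<^sup>* f (r s)\<close>. The dilation is therefore
  built as the space of all bounded families satisfying these equations, the bounded inverse limit
  of copies of \<open>H\<close> under the contractions \<open>(V r)\<^sup>*\<close>. The norms of the coordinates increase along the left
  ideals of \<open>S\<close>, which are directed by the Ore condition, so inner products converge by
  polarization. The unitaries act by twisted translation \<open>(U t f) s = \<omega> s t f (s t)\<close>, \<open>h \<in> H\<close>
  corresponds to the family \<open>V s h\<close>, and the squared distance from \<open>f\<close> to \<open>(U s)\<^sup>* (f s)\<close> is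
  \<open>\<parallel>f\<parallel>\<^sup>2 - \<parallel>f s\<parallel>\<^sup>2\<close>, which tends to \<open>0\<close>.\<close>

section \<open>Inner product spaces and Riesz representation\<close>

context complex_inner_space
begin

section \<open>Elementary identities for inner products and norms\<close>

lemma smult_add: "x \<in> carrier H \<Longrightarrow> y \<in> carrier H \<Longrightarrow> c \<odot> (x \<oplus> y) = c \<odot> x \<oplus> c \<odot> y"
  using smult_r_distr by (simp add: complex_ring_def)

lemma smult_smult: "x \<in> carrier H \<Longrightarrow> c \<odot> (d \<odot> x) = (c * d) \<odot> x"
  using smult_assoc1[of c d x] by (simp add: complex_ring_def)

lemma hdist_zero: "x \<in> carrier H \<Longrightarrow> hdist H x \<zero> = hnorm H x"
proof -
  assume x: "x \<in> carrier H"
  have "\<ominus> \<zero> = \<zero>" by (rule M.minus_equality) auto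
  then have "x \<ominus> \<zero> = x" using x by (simp only: a_minus_def M.r_zero)
  then show ?thesis using x by (simp add: hdist_def)
qed

lemma cinner_diff_left:
  assumes "x \<in> carrier H" "y \<in> carrier H" "z \<in> carrier H"
  shows "cinner H (x \<ominus> y) z = cinner H x z - cinner H y z"
  using assms by (simp add: a_minus_def cinner_add_left cinner_minus_left)

lemma cinner_eqI:
  assumes y: "y \<in> carrier H" and z: "z \<in> carrier H"
    and eq: "\<And>x. x \<in> carrier H \<Longrightarrow> cinner H y x = cinner H z x"
  shows "y = z"
proof -
  have "cinner H (y \<ominus> z) (y \<ominus> z) = 0"
    using y z eq[of "y \<ominus> z"] by (simp add: cinner_diff_left)
  then show ?thesis using y z cinner_eq_zeroD[of "y \<ominus> z"] diff_eq_zero_iff by simp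
qed

lemma hnorm_add_sq:
  assumes "x \<in> carrier H" "y \<in> carrier H"
  shows "(hnorm H (x \<oplus> y))\<^sup>2 = (hnorm H x)\<^sup>2 + (hnorm H y)\<^sup>2 + 2 * Re (cinner H x y)"
  using assms cinner_commute[of y x] by (simp add: hnorm_sq cinner_add_left cinner_add_right)

lemma hnorm_diff_sq:
  assumes "x \<in> carrier H" "y \<in> carrier H"
  shows "(hnorm H (x \<ominus> y))\<^sup>2 = (hnorm H x)\<^sup>2 + (hnorm H y)\<^sup>2 - 2 * Re (cinner H x y)"
  using assms by (simp add: a_minus_def hnorm_add_sq hnorm_minus cinner_minus_right)

lemma hnorm_smult:
  assumes "x \<in> carrier H" shows "hnorm H (c \<odot> x) = norm c * hnorm H x"
proof -
  have "cinner H (c \<odot> x) (c \<odot> x) = (c * cnj c) * cinner H x x"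
    using assms by (simp add: cinner_smult_left cinner_smult_right)
  also have "\<dots> = of_real ((norm c)\<^sup>2) * cinner H x x"
    by (simp only: complex_norm_square)
  finally show ?thesis
    by (simp add: hnorm_def real_sqrt_mult del: of_real_power)
qed

text \<open>Together with \<open>Im_cinner\<close> this is polarization: inner products are
  recovered from norms, so preservation or convergence of norms passes to inner products.\<close>

lemma Re_cinner:
  assumes "x \<in> carrier H" "y \<in> carrier H"
  shows "Re (cinner H x y) = ((hnorm H (x \<oplus> y))\<^sup>2 - (hnorm H x)\<^sup>2 - (hnorm H y)\<^sup>2) / 2"
  using assms by (simp add: hnorm_add_sq)

lemma Im_cinner:
  assumes "x \<in> carrier H" "y \<in> carrier H"
  shows "Im (cinner H x y) = - Re (cinner H (\<i> \<odot> x) y)"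
  using assms by (simp add: cinner_smult_left)

lemma tendsto_cinner_left:
  assumes lim: "limitin mtopology u z F" and y: "y \<in> carrier H"
  shows "((\<lambda>n. cinner H (u n) y) \<longlongrightarrow> cinner H z y) F"
proof -
  have z: "z \<in> carrier H" and u: "\<forall>\<^sub>F n in F. u n \<in> carrier H"
    and d: "((\<lambda>n. hdist H (u n) z) \<longlongrightarrow> 0) F"
    using lim by (auto simp: limitin_metric_dist_null)
  have "((\<lambda>n. hdist H (u n) z * hnorm H y) \<longlongrightarrow> 0) F"
    using d by (rule tendsto_mult_left_zero)
  then have "((\<lambda>n. cinner H (u n) y - cinner H z y) \<longlongrightarrow> 0) F"
  proof (rule Lim_null_comparison[rotated])
    show "\<forall>\<^sub>F n in F. norm (cinner H (u n) y - cinner H z y) \<le> hdist H (u n) z * hnorm H y"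
      using u
    proof eventually_elim
      case (elim n)
      then show ?case
        using z y Cauchy_Schwarz[of "u n \<ominus> z" y] by (simp add: hdist_def cinner_diff_left)
    qed
  qed
  then show ?thesis by (rule LIM_zero_cancel)
qed

text \<open>Polarization handles the real part, and the real part at \<open>\<i> \<odot> x\<close>
  handles the imaginary part.\<close>

lemma isometry_op_cinner:
  assumes T: "isometry_op H H T" and x: "x \<in> carrier H" and y: "y \<in> carrier H"
  shows "cinner H (T x) (T y) = cinner H x y"
proof -
  have carr: "T u \<in> carrier H" if "u \<in> carrier H" for u
    using T that by (auto simp: isometry_op_def linear_op_def)
  have add: "T u \<oplus> T v = T (u \<oplus> v)" if "u \<in> carrier H" "v \<in> carrier H" for u v
    using T that by (auto simp: isometry_op_def linear_op_def)
  have smult: "c \<odot> T u = T (c \<odot> u)" if "u \<in> carrier H" for u c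
    using T that by (auto simp: isometry_op_def linear_op_def)
  have norm: "hnorm H (T u) = hnorm H u" if "u \<in> carrier H" for u
    using T that by (auto simp: isometry_op_def)
  have re: "Re (cinner H (T u) (T v)) = Re (cinner H u v)"
    if "u \<in> carrier H" "v \<in> carrier H" for u v
    using that by (simp add: Re_cinner carr add norm)
  show ?thesis
    using x y by (simp add: complex_eq_iff re Im_cinner carr smult)
qed

end

section \<open>Riesz representation by minimisation\<close>

lemma (in complex_hilbert_space) Riesz_representation:
  assumes add: "\<And>x y. x \<in> carrier H \<Longrightarrow> y \<in> carrier H \<Longrightarrow> \<phi> (x \<oplus> y) = \<phi> x + \<phi> y"
    and smult: "\<And>c x. x \<in> carrier H \<Longrightarrow> \<phi> (c \<odot> x) = c * \<phi> x"
    and bounded: "\<And>x. x \<in> carrier H \<Longrightarrow> norm (\<phi> x) \<le> C * hnorm H x"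
  shows "\<exists>z\<in>carrier H. \<forall>x\<in>carrier H. \<phi> x = cinner H x z"
proof -
  \<comment> \<open>The representing vector is the minimiser of \<open>q\<close>.\<close>
  define q where "q x = (hnorm H x)\<^sup>2 - 2 * Re (\<phi> x)" for x
  define m where "m = (INF x\<in>carrier H. q x)"
  \<comment> \<open>Completing the square: \<open>q x\<close> is at least
    \<open>(hnorm H x - C)^2 - C^2\<close>.\<close>
  have lower: "q x \<ge> - C\<^sup>2" if "x \<in> carrier H" for x
  proof -
    have "Re (\<phi> x) \<le> C * hnorm H x"
      using bounded[OF that] complex_Re_le_cmod[of "\<phi> x"] by linarith
    moreover have "0 \<le> (hnorm H x - C)\<^sup>2" by simp
    ultimately show ?thesis unfolding q_def by (simp add: power2_diff algebra_simps)
  qed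
  then have bdd: "bdd_below (q ` carrier H)" by (auto intro!: bdd_belowI)
  then have m_le: "m \<le> q x" if "x \<in> carrier H" for x
    using that unfolding m_def by (rule cINF_lower)
  have "\<exists>x\<in>carrier H. q x < m + inverse (real (Suc n))" for n
    using cINF_less_iff[OF _ bdd, of "m + inverse (real (Suc n))"] M.zero_closed
    unfolding m_def by auto
  then obtain h where h: "\<And>n. h n \<in> carrier H"
    and qh: "\<And>n. q (h n) < m + inverse (real (Suc n))" by metis
  \<comment> \<open>The parallelogram law, combined with the lower bound \<open>m\<close> for
    \<open>q\<close> at the midpoint of \<open>a\<close> and \<open>b\<close>: near-minimisers are
    close together.\<close>
  have para: "(hdist H a b)\<^sup>2 \<le> 2 * (q a - m) + 2 * (q b - m)"
    if a: "a \<in> carrier H" and b: "b \<in> carrier H" for a b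
  proof -
    have "m \<le> q ((1/2) \<odot> (a \<oplus> b))" using a b by (intro m_le) simp
    then have "4 * m \<le> (hnorm H (a \<oplus> b))\<^sup>2 - 4 * Re (\<phi> a) - 4 * Re (\<phi> b)"
      using a b by (simp add: q_def hnorm_smult smult add power_mult_distrib power_divide field_simps)
    then show ?thesis
      using a b by (simp add: hdist_def hnorm_diff_sq hnorm_add_sq q_def)
  qed
  have "MCauchy h"
    unfolding MCauchy_def
  proof (intro conjI allI impI)
    show "range h \<subseteq> carrier H" using h by auto
    fix e :: real assume e: "e > 0"
    then obtain N where N: "inverse (real (Suc N)) < e\<^sup>2 / 8"
      using reals_Archimedean[of "e\<^sup>2 / 8"] by auto
    have "hdist H (h n) (h k) < e" if "N \<le> n" "N \<le> k" for n k
    proof -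
      have "q (h i) - m < e\<^sup>2 / 8" if "N \<le> i" for i
      proof -
        have "inverse (real (Suc i)) \<le> inverse (real (Suc N))"
          using that by (intro le_imp_inverse_le) auto
        then show ?thesis using qh[of i] N by linarith
      qed
      from this[OF \<open>N \<le> n\<close>] this[OF \<open>N \<le> k\<close>]
      have "(hdist H (h n) (h k))\<^sup>2 < 2 * (e\<^sup>2 / 8) + 2 * (e\<^sup>2 / 8)"
        by (intro order.strict_trans1[OF para[OF h h]] add_strict_mono mult_strict_left_mono) auto
      also have "\<dots> \<le> e\<^sup>2" by simp
      finally have "(hdist H (h n) (h k))\<^sup>2 < e\<^sup>2" .
      then show ?thesis using e by (simp add: power_less_imp_less_base)
    qed
    then show "\<exists>N. \<forall>n n'. N \<le> n \<longrightarrow> N \<le> n' \<longrightarrow> hdist H (h n) (h n') < e" by blast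
  qed
  then obtain z where z: "limitin mtopology h z sequentially"
    using complete by (auto simp: mcomplete_def)
  have zc: "z \<in> carrier H" using z by (simp add: limitin_metric)
  have "\<phi> x = cinner H x z" if x: "x \<in> carrier H" for x
  proof -
    \<comment> \<open>Moving from \<open>z\<close> by \<open>c \<odot> x\<close> does not lower
      \<open>q\<close>. The inequality is a limit along \<open>h n\<close>, so only continuity of
      the inner product enters, not that of \<open>q\<close>.\<close>
    have var: "0 \<le> (norm c)\<^sup>2 * (hnorm H x)\<^sup>2 + 2 * Re (c * (cinner H x z - \<phi> x))" for c
    proof -
      have "((\<lambda>n. cinner H x (h n)) \<longlongrightarrow> cinner H x z) sequentially"
        using tendsto_cnj[OF tendsto_cinner_left[OF z x]] cinner_commute[OF x h]
          cinner_commute[OF x zc] by simp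
      then have lim: "((\<lambda>n. (norm c)\<^sup>2 * (hnorm H x)\<^sup>2 + 2 * Re (c * (cinner H x (h n) - \<phi> x))
            + inverse (real (Suc n))) \<longlongrightarrow>
          (norm c)\<^sup>2 * (hnorm H x)\<^sup>2 + 2 * Re (c * (cinner H x z - \<phi> x)) + 0) sequentially"
        by (intro tendsto_intros LIMSEQ_inverse_real_of_nat)
      have nonneg: "0 \<le> (norm c)\<^sup>2 * (hnorm H x)\<^sup>2 + 2 * Re (c * (cinner H x (h n) - \<phi> x))
            + inverse (real (Suc n))" for n
      proof -
        have "m \<le> q (c \<odot> x \<oplus> h n)" using x h by (intro m_le) simp
        also have "\<dots> = q (h n) + (norm c)\<^sup>2 * (hnorm H x)\<^sup>2 + 2 * Re (c * (cinner H x (h n) - \<phi> x))"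
          using x h by (simp add: q_def hnorm_add_sq hnorm_smult power_mult_distrib add smult
              cinner_smult_left algebra_simps)
        finally show ?thesis using qh[of n] by linarith
      qed
      show ?thesis
        using LIMSEQ_le_const[OF lim, of 0] nonneg by simp
    qed
    define a where "a = \<phi> x - cinner H x z"
    define N where "N = (hnorm H x)\<^sup>2"
    \<comment> \<open>With this step length the quadratic term of \<open>var\<close> at
      \<open>c = of_real t * cnj a\<close> is too small to compensate the linear one unless
      \<open>a = 0\<close>.\<close>
    define t where "t = 1 / (N + 1)"
    have N: "N \<ge> 0" by (simp add: N_def)
    have t: "t > 0" "t * N < 1" using N by (simp_all add: t_def field_simps)
    have "0 \<le> (norm (of_real t * cnj a))\<^sup>2 * N + 2 * Re (of_real t * cnj a * (- a))"
      using var[of "of_real t * cnj a"] by (simp add: a_def N_def)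
    also have "of_real t * cnj a * (- a) = - of_real (t * (norm a)\<^sup>2)"
      by (simp only: complex_norm_square of_real_mult) (simp add: algebra_simps)
    also have "(norm (of_real t * cnj a))\<^sup>2 = t\<^sup>2 * (norm a)\<^sup>2"
      by (simp add: norm_mult power_mult_distrib)
    finally have "0 \<le> (t * (norm a)\<^sup>2) * (t * N - 2)"
      by (simp add: power2_eq_square algebra_simps del: of_real_mult of_real_power)
    moreover have "t * N - 2 < 0" using t by simp
    ultimately have "t * (norm a)\<^sup>2 \<le> 0" by (meson mult_pos_neg not_le)
    then have "a = 0" using t(1) by (simp add: mult_le_0_iff)
    then show ?thesis by (simp add: a_def)
  qed
  then show ?thesis using zc by blast
qed

section \<open>The filter of left ideals\<close>

lemma ore_common_multiple:
  fixes s t :: "'s::ore_semigroup"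
  obtains p q where "p * s = q * t"
  using ore[of s t] by blast

text \<open>The Ore condition makes the left ideals \<open>S s\<close> a filter base.\<close>

definition ore_filter :: "'s::ore_semigroup filter" where
  "ore_filter = (INF s. principal (range (\<lambda>r. r * s)))"

text \<open>A common multiple \<open>p * a = q * b\<close> generates a left ideal inside both
  \<open>S a\<close> and \<open>S b\<close>, so a single ideal decides what holds
  eventually.\<close>

lemma eventually_ore_filter:
  "eventually P (ore_filter :: 's::ore_semigroup filter) \<longleftrightarrow> (\<exists>s. \<forall>r. P (r * s))"
proof -
  have "\<exists>x\<in>UNIV. principal (range (\<lambda>r. r * x)) \<le>
      inf (principal (range (\<lambda>r. r * a))) (principal (range (\<lambda>r. r * b)))" for a b :: 's
  proof -
    obtain p q where "p * a = q * b" by (rule ore_common_multiple)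
    then have "r * (p * a) = r * p * a" "r * (p * a) = r * q * b" for r
      by (simp_all add: mult.assoc)
    then have "range (\<lambda>r. r * (p * a)) \<subseteq> range (\<lambda>r. r * a) \<inter> range (\<lambda>r. r * b)"
      by blast
    then show ?thesis by auto
  qed
  then show ?thesis
    unfolding ore_filter_def by (subst eventually_INF_base) (auto simp: eventually_principal)
qed

lemma ore_filter_neq_bot [simp]: "ore_filter \<noteq> bot"
  by (simp add: trivial_limit_def eventually_ore_filter)

text \<open>If \<open>p * t = q * s\<close>, then right translation by \<open>t\<close> sends
  \<open>S p\<close> into \<open>S s\<close>. This is why twisted translation preserves the limit
  inner product.\<close>

lemma filterlim_mult_right_ore: "filterlim (\<lambda>s. s * t) ore_filter ore_filter"
  unfolding filterlim_iff
proof (intro allI impI)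
  fix P :: "'a \<Rightarrow> bool" assume "eventually P ore_filter"
  then obtain s where s: "\<And>r. P (r * s)" by (auto simp: eventually_ore_filter)
  obtain p q where "p * t = q * s" by (rule ore_common_multiple)
  then have "P (r * p * t)" for r using s[of "r * q"] by (simp add: mult.assoc)
  then show "\<forall>\<^sub>F x in ore_filter. P (x * t)" by (auto simp: eventually_ore_filter)
qed

section \<open>The dilation space\<close>

locale isometric_ore_rep = complex_hilbert_space H for H :: "'a cinner_space" (structure) +
  fixes \<omega> :: "'s::ore_semigroup \<Rightarrow> 's \<Rightarrow> complex"
    and V :: "'s \<Rightarrow> 'a \<Rightarrow> 'a"
  assumes multiplier: "circle_multiplier \<omega>"
    and rep: "isometric_rep H \<omega> V"
begin

section \<open>Calculus of the multiplier and the isometries\<close>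

lemma norm_multiplier [simp]: "norm (\<omega> s t) = 1"
  using multiplier by (simp add: circle_multiplier_def)

lemma multiplier_cnj [simp]: "\<omega> s t * cnj (\<omega> s t) = 1" "cnj (\<omega> s t) * \<omega> s t = 1"
  "\<omega> s t * (cnj (\<omega> s t) * z) = z" "cnj (\<omega> s t) * (\<omega> s t * z) = z"
proof -
  show *: "\<omega> s t * cnj (\<omega> s t) = 1"
    using complex_norm_square[of "\<omega> s t"] by simp
  then show **: "cnj (\<omega> s t) * \<omega> s t = 1" by (simp add: mult.commute)
  show "\<omega> s t * (cnj (\<omega> s t) * z) = z" "cnj (\<omega> s t) * (\<omega> s t * z) = z"
    using * ** by (simp_all only: mult.assoc[symmetric] mult_1)
qed

lemma cocycle: "\<omega> r s * \<omega> (r * s) t = \<omega> r (s * t) * \<omega> s t"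
  using multiplier by (simp add: circle_multiplier_def)

lemma isometry_V: "isometry_op H H (V s)"
  using rep by (simp add: isometric_rep_def)

lemma V_closed [simp]: "x \<in> carrier H \<Longrightarrow> V s x \<in> carrier H"
  using isometry_V[of s] by (auto simp: isometry_op_def linear_op_def)

lemma V_add: "x \<in> carrier H \<Longrightarrow> y \<in> carrier H \<Longrightarrow> V s (x \<oplus> y) = V s x \<oplus> V s y"
  using isometry_V[of s] by (auto simp: isometry_op_def linear_op_def)

lemma V_smult: "x \<in> carrier H \<Longrightarrow> V s (c \<odot> x) = c \<odot> V s x"
  using isometry_V[of s] by (auto simp: isometry_op_def linear_op_def)

lemma hnorm_V [simp]: "x \<in> carrier H \<Longrightarrow> hnorm H (V s x) = hnorm H x"
  using isometry_V[of s] by (auto simp: isometry_op_def)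

lemma cinner_V [simp]:
  "x \<in> carrier H \<Longrightarrow> y \<in> carrier H \<Longrightarrow> cinner H (V s x) (V s y) = cinner H x y"
  by (rule isometry_op_cinner[OF isometry_V])

lemma V_V: "x \<in> carrier H \<Longrightarrow> V s (V t x) = \<omega> s t \<odot> V (s * t) x"
  using rep by (simp add: isometric_rep_def)

text \<open>The equation is \<open>f s = \<omega> r s (V r)\<^sup>* f (r s)\<close>, tested against \<open>x\<close> to avoid the adjoint.\<close>

definition threads :: "('s \<Rightarrow> 'a) set" where
  "threads = {f. (\<forall>s. f s \<in> carrier H) \<and>
     (\<forall>r s. \<forall>x\<in>carrier H. \<omega> r s * cinner H (f (r * s)) (V r x) = cinner H (f s) x) \<and>
     (\<exists>C. \<forall>s. hnorm H (f s) \<le> C)}"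

lemma threadsI:
  assumes "\<And>s. f s \<in> carrier H"
    and "\<And>r s x. x \<in> carrier H \<Longrightarrow> \<omega> r s * cinner H (f (r * s)) (V r x) = cinner H (f s) x"
    and "\<And>s. hnorm H (f s) \<le> C"
  shows "f \<in> threads"
  using assms unfolding threads_def by blast

section \<open>Threads: linear structure and growth of norms\<close>

lemma thread_closed [simp]: "f \<in> threads \<Longrightarrow> f s \<in> carrier H"
  unfolding threads_def by blast

lemma thread_cinner:
  "f \<in> threads \<Longrightarrow> x \<in> carrier H \<Longrightarrow> \<omega> r s * cinner H (f (r * s)) (V r x) = cinner H (f s) x"
  unfolding threads_def by blast

lemma thread_bounded: "f \<in> threads \<Longrightarrow> \<exists>C. \<forall>s. hnorm H (f s) \<le> C"
  unfolding threads_def by blast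

text \<open>A common left factor \<open>a\<close> costs only a phase: the thread equation at
  \<open>q\<close> is tested against \<open>V r x\<close>, and \<open>V a (V r x)\<close> merges
  into \<open>V (a * r) x\<close>. Independence of choices in \<open>dilation_op_surj\<close> rests
  on this.\<close>

lemma thread_cinner_mult:
  assumes f: "f \<in> threads" and x: "x \<in> carrier H"
  shows "cinner H (f (a * q)) (V (a * r) x) = \<omega> a r * cnj (\<omega> a q) * cinner H (f q) (V r x)"
proof -
  have "cinner H (f q) (V r x) = \<omega> a q * (cnj (\<omega> a r) * cinner H (f (a * q)) (V (a * r) x))"
    using thread_cinner[OF f, of "V r x" a q] f x by (simp add: V_V cinner_smult_right)
  then show ?thesis by (simp add: mult.assoc)
qed

text \<open>Up to a phase, \<open>f s\<close> is the image of \<open>f (r * s)\<close> under the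
  contraction adjoint to \<open>V r\<close>. Testing the thread equation against \<open>f s\<close>
  itself and applying Cauchy-Schwarz makes this precise.\<close>

lemma hnorm_thread_le:
  assumes f: "f \<in> threads" shows "hnorm H (f s) \<le> hnorm H (f (r * s))"
proof (cases "hnorm H (f s) = 0")
  case True
  then show ?thesis using f by (simp add: hnorm_ge_zero)
next
  case False
  have "(hnorm H (f s))\<^sup>2 = Re (cinner H (f s) (f s))" using f by (simp add: hnorm_sq)
  also have "\<dots> = Re (\<omega> r s * cinner H (f (r * s)) (V r (f s)))"
    using f by (simp add: thread_cinner)
  also have "\<dots> \<le> norm (\<omega> r s * cinner H (f (r * s)) (V r (f s)))" by (rule complex_Re_le_cmod)
  also have "\<dots> \<le> hnorm H (f (r * s)) * hnorm H (f s)"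
    using f Cauchy_Schwarz[of "f (r * s)" "V r (f s)"] by (simp add: norm_mult)
  finally show ?thesis
    using False hnorm_ge_zero[of "f s"] f by (simp add: power2_eq_square)
qed

lemma thread_zero: "(\<lambda>_. \<zero>) \<in> threads"
  by (rule threadsI[where C = 0]) (auto simp: hnorm_eq_zero[THEN iffD2])

lemma thread_add:
  assumes f: "f \<in> threads" and g: "g \<in> threads" shows "(\<lambda>s. f s \<oplus> g s) \<in> threads"
proof -
  obtain C D where C: "\<And>s. hnorm H (f s) \<le> C" and D: "\<And>s. hnorm H (g s) \<le> D"
    using thread_bounded[OF f] thread_bounded[OF g] by blast
  have "hnorm H (f s \<oplus> g s) \<le> C + D" for s
    using hnorm_triangle[of "f s" "g s"] C[of s] D[of s] f g by simp
  then show ?thesis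
    using f g by (intro threadsI[where C = "C + D"])
      (auto simp: cinner_add_left distrib_left thread_cinner)
qed

lemma thread_smult:
  assumes f: "f \<in> threads" shows "(\<lambda>s. c \<odot> f s) \<in> threads"
proof -
  obtain C where C: "\<And>s. hnorm H (f s) \<le> C" using thread_bounded[OF f] by blast
  show ?thesis
    using f C by (intro threadsI[where C = "norm c * C"])
      (auto simp: cinner_smult_left hnorm_smult mult.left_commute thread_cinner mult_left_mono)
qed

text \<open>The squared norms are bounded and increase under left multiplication of the index, so
  they converge to their supremum.\<close>

lemma thread_hnorm_tendsto:
  assumes f: "f \<in> threads"
  shows "\<exists>l. ((\<lambda>s. (hnorm H (f s))\<^sup>2) \<longlongrightarrow> l) ore_filter \<and> (\<forall>s. (hnorm H (f s))\<^sup>2 \<le> l)"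
proof -
  define n where "n s = (hnorm H (f s))\<^sup>2" for s
  obtain C where C: "\<And>s. hnorm H (f s) \<le> C" using thread_bounded[OF f] by blast
  have "n s \<le> C\<^sup>2" for s
    unfolding n_def using C f by (intro power_mono) (auto simp: hnorm_ge_zero)
  then have bdd: "bdd_above (range n)" by (auto intro!: bdd_aboveI)
  have mono: "n s \<le> n (r * s)" for r s
    unfolding n_def using f by (intro power_mono hnorm_thread_le) (auto simp: hnorm_ge_zero)
  have le: "n s \<le> (SUP s. n s)" for s by (rule cSUP_upper[OF UNIV_I bdd])
  have "(n \<longlongrightarrow> (SUP s. n s)) ore_filter"
  proof (rule order_tendstoI)
    fix a assume "a < (SUP s. n s)"
    then obtain s where "a < n s" using less_cSUP_iff[OF UNIV_not_empty bdd] by auto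
    then have "a < n (r * s)" for r using mono[of s r] by simp
    then show "\<forall>\<^sub>F s in ore_filter. a < n s" by (auto simp: eventually_ore_filter)
  next
    fix a assume "(SUP s. n s) < a"
    then have "n s < a" for s using le[of s] by simp
    then show "\<forall>\<^sub>F s in ore_filter. n s < a" by simp
  qed
  then show ?thesis using le unfolding n_def by blast
qed

text \<open>\<open>Lim\<close> is total; that it is a genuine limit on threads is shown in
  \<open>cinner_dilation_tendsto\<close>.\<close>

definition dilation :: "('s \<Rightarrow> 'a) cinner_space" where
  "dilation = \<lparr>carrier = threads, mult = undefined, one = undefined,
     zero = (\<lambda>_. \<zero>), add = (\<lambda>f g s. f s \<oplus> g s), smult = (\<lambda>c f s. c \<odot> f s),
     cinner = (\<lambda>f g. Lim ore_filter (\<lambda>s. cinner H (f s) (g s)))\<rparr>"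

abbreviation (input) "K \<equiv> dilation"

lemma dilation_simps [simp]:
  "carrier K = threads" "zero K = (\<lambda>_. \<zero>)" "add K = (\<lambda>f g s. f s \<oplus> g s)"
  "smult K = (\<lambda>c f s. c \<odot> f s)"
  by (simp_all add: dilation_def)

section \<open>The limit inner product\<close>

lemma cinner_dilation_tendsto:
  assumes f: "f \<in> threads" and g: "g \<in> threads"
  shows "((\<lambda>s. cinner H (f s) (g s)) \<longlongrightarrow> cinner K f g) ore_filter"
proof -
  \<comment> \<open>Stated for every thread \<open>f\<close>, because it is applied again to
    \<open>\<i> \<odot> f s\<close> to obtain the imaginary part.\<close>
  have re: "\<exists>l. ((\<lambda>s. Re (cinner H (f s) (g s))) \<longlongrightarrow> l) ore_filter"
    if f: "f \<in> threads" for f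
  proof -
    obtain a b c where "((\<lambda>s. (hnorm H (f s))\<^sup>2) \<longlongrightarrow> a) ore_filter"
      "((\<lambda>s. (hnorm H (g s))\<^sup>2) \<longlongrightarrow> b) ore_filter"
      "((\<lambda>s. (hnorm H (f s \<oplus> g s))\<^sup>2) \<longlongrightarrow> c) ore_filter"
      using thread_hnorm_tendsto f g thread_add by meson
    then have "((\<lambda>s. ((hnorm H (f s \<oplus> g s))\<^sup>2 - (hnorm H (f s))\<^sup>2 - (hnorm H (g s))\<^sup>2) / 2)
        \<longlongrightarrow> (c - a - b) / 2) ore_filter"
      by (intro tendsto_intros) auto
    then show ?thesis using f g by (auto simp: Re_cinner)
  qed
  obtain a where a: "((\<lambda>s. Re (cinner H (f s) (g s))) \<longlongrightarrow> a) ore_filter"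
    using re[OF f] by blast
  obtain b where b: "((\<lambda>s. Re (cinner H (\<i> \<odot> f s) (g s))) \<longlongrightarrow> b) ore_filter"
    using re[OF thread_smult[OF f]] by blast
  have "((\<lambda>s. Complex (Re (cinner H (f s) (g s))) (- Re (cinner H (\<i> \<odot> f s) (g s))))
      \<longlongrightarrow> Complex a (- b)) ore_filter"
    by (intro tendsto_Complex tendsto_minus a b)
  moreover have "Complex (Re (cinner H (f s) (g s))) (- Re (cinner H (\<i> \<odot> f s) (g s)))
      = cinner H (f s) (g s)" for s
    using f g Im_cinner[of "f s" "g s"] by (simp add: complex_eq_iff)
  ultimately have "((\<lambda>s. cinner H (f s) (g s)) \<longlongrightarrow> Complex a (- b)) ore_filter" by simp
  then show ?thesis by (simp add: dilation_def tendsto_Lim)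
qed

lemma cinner_dilation_eqI:
  assumes "f \<in> threads" "g \<in> threads"
    and "((\<lambda>s. cinner H (f s) (g s)) \<longlongrightarrow> l) ore_filter"
  shows "cinner K f g = l"
  using tendsto_unique[OF ore_filter_neq_bot cinner_dilation_tendsto] assms by blast

lemma hnorm_dilation_tendsto:
  assumes f: "f \<in> threads"
  shows "((\<lambda>s. (hnorm H (f s))\<^sup>2) \<longlongrightarrow> Re (cinner K f f)) ore_filter"
  using tendsto_Re[OF cinner_dilation_tendsto[OF f f]] f by (simp add: hnorm_sq)

lemma hnorm_sq_le_cinner_dilation:
  assumes f: "f \<in> threads" shows "(hnorm H (f s))\<^sup>2 \<le> Re (cinner K f f)"
  using thread_hnorm_tendsto[OF f] tendsto_unique[OF ore_filter_neq_bot hnorm_dilation_tendsto[OF f]]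
  by blast

lemma complex_inner_space_dilation: "complex_inner_space K"
proof (intro complex_inner_space.intro moduleI complex_inner_space_axioms.intro)
  show "cring complex_ring" by (rule R.is_cring)
  show "abelian_group K"
  proof (rule abelian_groupI)
    show "\<exists>g\<in>carrier K. g \<oplus>\<^bsub>K\<^esub> f = \<zero>\<^bsub>K\<^esub>" if "f \<in> carrier K" for f
    proof
      show "(\<lambda>s. (-1) \<odot> f s) \<in> carrier K" using that by (simp add: thread_smult)
      have "(-1) \<odot> x \<oplus> x = \<zero>" if "x \<in> carrier H" for x
        using that smult_l_distr[of "-1" 1 x] smult_one[of x] smult_l_null[of x]
        by (simp add: complex_ring_def)
      then show "(\<lambda>s. (-1) \<odot> f s) \<oplus>\<^bsub>K\<^esub> f = \<zero>\<^bsub>K\<^esub>" using that by simp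
    qed
  qed (auto simp: thread_zero thread_add M.a_assoc intro!: ext M.a_comm)
next
  fix f g h c
  show "cinner K f g = cnj (cinner K g f)" if "f \<in> carrier K" "g \<in> carrier K"
  proof (rule cinner_dilation_eqI)
    have "cnj (cinner H (g s) (f s)) = cinner H (f s) (g s)" for s
      using that cinner_commute[of "f s" "g s"] by simp
    then show "((\<lambda>s. cinner H (f s) (g s)) \<longlongrightarrow> cnj (cinner K g f)) ore_filter"
      using tendsto_cnj[OF cinner_dilation_tendsto[of g f]] that by simp
  qed (use that in auto)
  show "cinner K (f \<oplus>\<^bsub>K\<^esub> g) h = cinner K f h + cinner K g h"
    if "f \<in> carrier K" "g \<in> carrier K" "h \<in> carrier K"
    using that tendsto_add[OF cinner_dilation_tendsto[of f h] cinner_dilation_tendsto[of g h]]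
    by (intro cinner_dilation_eqI) (auto simp: thread_add cinner_add_left)
  show "cinner K (c \<odot>\<^bsub>K\<^esub> f) g = c * cinner K f g" if "f \<in> carrier K" "g \<in> carrier K"
    using that tendsto_mult_left[OF cinner_dilation_tendsto[of f g]]
    by (intro cinner_dilation_eqI) (auto simp: thread_smult cinner_smult_left)
  show "0 \<le> Re (cinner K f f)" if "f \<in> carrier K"
    using that by (intro order_trans[OF zero_le_power2 hnorm_sq_le_cinner_dilation]) simp
  \<comment> \<open>Every coordinate norm is at most the limit norm, so a null vector vanishes in
    each coordinate and no quotient has to be taken.\<close>
  show "f = \<zero>\<^bsub>K\<^esub>" if "f \<in> carrier K" "cinner K f f = 0"
    using hnorm_sq_le_cinner_dilation[of f] that by (auto simp: hnorm_eq_zero)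
qed (auto simp: thread_smult complex_ring_def smult_l_distr[unfolded complex_ring_def, simplified]
      smult_r_distr[unfolded complex_ring_def, simplified]
      smult_assoc1[unfolded complex_ring_def, simplified]
      smult_one[unfolded complex_ring_def, simplified])

sublocale K: complex_inner_space dilation
  by (rule complex_inner_space_dilation)

section \<open>The supremum norm and completeness\<close>

lemma hnorm_le_hnorm_dilation:
  assumes "f \<in> threads" shows "hnorm H (f s) \<le> hnorm K f"
proof (rule power2_le_imp_le)
  show "(hnorm H (f s))\<^sup>2 \<le> (hnorm K f)\<^sup>2"
    using assms hnorm_sq_le_cinner_dilation[of f s] by (simp add: K.hnorm_sq)
qed (use assms in \<open>simp add: K.hnorm_ge_zero\<close>)

text \<open>With \<open>hnorm_le_hnorm_dilation\<close> this identifies the norm as the supremum of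
  the coordinate norms, so convergence in \<open>dilation\<close> is uniform convergence.\<close>

lemma hnorm_dilation_le:
  assumes f: "f \<in> threads" and le: "\<And>s. hnorm H (f s) \<le> C" shows "hnorm K f \<le> C"
proof (rule power2_le_imp_le)
  show C: "0 \<le> C" by (rule order_trans[OF hnorm_ge_zero[OF thread_closed[OF f]] le])
  have "(hnorm H (f s))\<^sup>2 \<le> C\<^sup>2" for s
    using f le by (intro power_mono) (auto simp: hnorm_ge_zero)
  then have "Re (cinner K f f) \<le> C\<^sup>2"
    by (intro tendsto_upperbound[OF hnorm_dilation_tendsto[OF f]]) auto
  then show "(hnorm K f)\<^sup>2 \<le> C\<^sup>2" using f by (simp add: K.hnorm_sq)
qed

text \<open>Negatives in \<open>dilation\<close> are given by a description, not pointwise; the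
  pointwise formula for differences is recovered by adding \<open>g\<close> and cancelling.\<close>

lemma diff_dilation:
  assumes f: "f \<in> threads" and g: "g \<in> threads"
  shows "f \<ominus>\<^bsub>K\<^esub> g \<in> threads" "(f \<ominus>\<^bsub>K\<^esub> g) s = f s \<ominus> g s"
proof -
  show d: "f \<ominus>\<^bsub>K\<^esub> g \<in> threads" using f g K.M.minus_closed[of f g] by simp
  have "(f \<ominus>\<^bsub>K\<^esub> g) \<oplus>\<^bsub>K\<^esub> g = f \<oplus>\<^bsub>K\<^esub> (\<ominus>\<^bsub>K\<^esub> g \<oplus>\<^bsub>K\<^esub> g)"
    unfolding a_minus_def using f g K.M.a_inv_closed by (intro K.M.a_assoc) auto
  also have "\<ominus>\<^bsub>K\<^esub> g \<oplus>\<^bsub>K\<^esub> g = \<zero>\<^bsub>K\<^esub>" by (rule K.M.l_neg) (simp add: g)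
  also have "f \<oplus>\<^bsub>K\<^esub> \<zero>\<^bsub>K\<^esub> = f" by (rule K.M.r_zero) (simp add: f)
  finally have "(f \<ominus>\<^bsub>K\<^esub> g) s \<oplus> g s = f s" by (simp add: fun_eq_iff)
  moreover have "x \<oplus> y \<ominus> y = x" if "x \<in> carrier H" "y \<in> carrier H" for x y
    using that by (simp add: a_minus_def M.a_assoc M.r_neg)
  ultimately show "(f \<ominus>\<^bsub>K\<^esub> g) s = f s \<ominus> g s" using thread_closed[OF d] thread_closed[OF g] by metis
qed

lemma hdist_dilation_le:
  assumes f: "f \<in> threads" and g: "g \<in> threads"
    and le: "\<And>s. hdist H (f s) (g s) \<le> C"
  shows "hdist K f g \<le> C"
  using assms hnorm_dilation_le[OF diff_dilation(1)[OF f g], of C]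
  by (simp add: hdist_def diff_dilation)

lemma hdist_le_hdist_dilation:
  assumes f: "f \<in> threads" and g: "g \<in> threads"
  shows "hdist H (f s) (g s) \<le> hdist K f g"
  using assms hnorm_le_hnorm_dilation[OF diff_dilation(1)[OF f g], of s]
  by (simp add: hdist_def diff_dilation)

text \<open>A Cauchy sequence converges in each coordinate, uniformly over the coordinates. The
  thread equations pass to the limit because they only involve inner products with fixed
  vectors.\<close>

lemma complex_hilbert_space_dilation: "complex_hilbert_space K"
proof (intro complex_hilbert_space.intro complex_hilbert_space_axioms.intro
    complex_inner_space_dilation)
  show "K.mcomplete"
    unfolding K.mcomplete_def
  proof (intro allI impI)
    fix \<sigma> assume "K.MCauchy \<sigma>"
    then have \<sigma>: "\<And>n. \<sigma> n \<in> threads"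
      and cauchy: "\<And>e. e > 0 \<Longrightarrow> \<exists>N. \<forall>n k. N \<le> n \<longrightarrow> N \<le> k \<longrightarrow> hdist K (\<sigma> n) (\<sigma> k) < e"
      unfolding K.MCauchy_def by auto
    have "MCauchy (\<lambda>n. \<sigma> n s)" for s
      unfolding MCauchy_def
    proof (intro conjI allI impI)
      show "range (\<lambda>n. \<sigma> n s) \<subseteq> carrier H" using \<sigma> by auto
      fix e :: real assume "e > 0"
      then show "\<exists>N. \<forall>n k. N \<le> n \<longrightarrow> N \<le> k \<longrightarrow> hdist H (\<sigma> n s) (\<sigma> k s) < e"
        using cauchy hdist_le_hdist_dilation[OF \<sigma> \<sigma>] by (meson le_less_trans)
    qed
    then have "\<forall>s. \<exists>y. limitin mtopology (\<lambda>n. \<sigma> n s) y sequentially"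
      using complete unfolding mcomplete_def by blast
    then obtain f where f: "\<And>s. limitin mtopology (\<lambda>n. \<sigma> n s) (f s) sequentially"
      by metis
    have fc: "f s \<in> carrier H" for s using f[of s] by (simp add: limitin_metric)
    \<comment> \<open>Letting \<open>k\<close> tend to infinity in the triangle inequality through
      \<open>\<sigma> k s\<close> gives a bound in which \<open>N\<close> does not depend on
      \<open>s\<close>.\<close>
    have unif: "hdist H (\<sigma> n s) (f s) \<le> e"
      if N: "\<forall>n k. N \<le> n \<longrightarrow> N \<le> k \<longrightarrow> hdist K (\<sigma> n) (\<sigma> k) < e" and n: "N \<le> n" for N e n s
    proof -
      have "(\<lambda>k. hdist H (\<sigma> k s) (f s)) \<longlonglongrightarrow> 0"
        using f[of s] by (simp add: limitin_metric_dist_null)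
      then have lim: "(\<lambda>k. e + hdist H (\<sigma> k s) (f s)) \<longlonglongrightarrow> e + 0"
        by (intro tendsto_add tendsto_const)
      have "hdist H (\<sigma> n s) (f s) \<le> e + hdist H (\<sigma> k s) (f s)" if "N \<le> k" for k
      proof -
        have "hdist K (\<sigma> n) (\<sigma> k) < e" using N n that by blast
        then show ?thesis
          using triangle[OF thread_closed[OF \<sigma>, of n s] thread_closed[OF \<sigma>, of k s] fc[of s]]
            hdist_le_hdist_dilation[OF \<sigma> \<sigma>, of n s k] by linarith
      qed
      then show ?thesis using LIMSEQ_le_const[OF lim] by auto
    qed
    obtain N where N: "\<forall>n k. N \<le> n \<longrightarrow> N \<le> k \<longrightarrow> hdist K (\<sigma> n) (\<sigma> k) < 1"
      using cauchy[of 1] by auto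
    have fK: "f \<in> threads"
    proof (rule threadsI)
      show "hnorm H (f s) \<le> 1 + hnorm K (\<sigma> N)" for s
        using triangle[of "f s" "\<sigma> N s" \<zero>] unif[OF N order_refl, of s] \<sigma>[of N] fc[of s]
          hnorm_le_hnorm_dilation[OF \<sigma>, of N s] commute[of "f s" "\<sigma> N s"]
        by (simp add: hdist_zero)
      show "\<omega> r s * cinner H (f (r * s)) (V r x) = cinner H (f s) x" if x: "x \<in> carrier H" for r s x
      proof (rule tendsto_unique[OF sequentially_bot])
        have "(\<lambda>n. \<omega> r s * cinner H (\<sigma> n (r * s)) (V r x))
            \<longlonglongrightarrow> \<omega> r s * cinner H (f (r * s)) (V r x)"
          using x by (intro tendsto_mult_left tendsto_cinner_left[OF f]) simp
        then show "(\<lambda>n. cinner H (\<sigma> n s) x) \<longlonglongrightarrow> \<omega> r s * cinner H (f (r * s)) (V r x)"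
          using \<sigma> x by (simp add: thread_cinner)
        show "(\<lambda>n. cinner H (\<sigma> n s) x) \<longlonglongrightarrow> cinner H (f s) x"
          by (rule tendsto_cinner_left[OF f x])
      qed
    qed (rule fc)
    have "limitin K.mtopology \<sigma> f sequentially"
      unfolding K.limitin_metric
    proof (intro conjI allI impI)
      show "f \<in> carrier K" using fK by simp
      fix e :: real assume "e > 0"
      then obtain N where N: "\<forall>n k. N \<le> n \<longrightarrow> N \<le> k \<longrightarrow> hdist K (\<sigma> n) (\<sigma> k) < e / 2"
        using cauchy[of "e / 2"] by auto
      have "hdist K (\<sigma> n) f < e" if "N \<le> n" for n
        using hdist_dilation_le[OF \<sigma> fK unif[OF N that]] \<open>e > 0\<close> by simp
      then show "\<forall>\<^sub>F n in sequentially. \<sigma> n \<in> carrier K \<and> hdist K (\<sigma> n) f < e"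
        using \<sigma> by (auto simp: eventually_sequentially)
    qed
    then show "\<exists>f. limitin K.mtopology \<sigma> f sequentially" by blast
  qed
qed

subsection \<open>The unitary representation and the embedding\<close>

definition dilation_op :: "'s \<Rightarrow> ('s \<Rightarrow> 'a) \<Rightarrow> 's \<Rightarrow> 'a" where
  "dilation_op t f = (\<lambda>s. \<omega> s t \<odot> f (s * t))"

definition dilation_embed :: "'a \<Rightarrow> 's \<Rightarrow> 'a" where
  "dilation_embed h = (\<lambda>s. V s h)"

lemma dilation_embed_closed [simp]: "h \<in> carrier H \<Longrightarrow> dilation_embed h \<in> threads"
  unfolding dilation_embed_def
  by (rule threadsI[where C = "hnorm H h"])
    (auto simp: V_V[symmetric] cinner_smult_left[symmetric])


text \<open>The cocycle identity at \<open>r\<close>, \<open>s\<close>, \<open>t\<close> reduces the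
  new thread equation at \<open>s\<close> to \<open>\<omega> s t\<close> times that of
  \<open>f\<close> at \<open>s * t\<close>.\<close>

lemma dilation_op_closed [simp]:
  assumes f: "f \<in> threads" shows "dilation_op t f \<in> threads"
  unfolding dilation_op_def
proof (rule threadsI)
  show "\<omega> r s * cinner H (\<omega> (r * s) t \<odot> f (r * s * t)) (V r x) = cinner H (\<omega> s t \<odot> f (s * t)) x"
    if x: "x \<in> carrier H" for r s x
  proof -
    have "\<omega> r s * cinner H (\<omega> (r * s) t \<odot> f (r * s * t)) (V r x)
        = (\<omega> r s * \<omega> (r * s) t) * cinner H (f (r * (s * t))) (V r x)"
      using f x by (simp add: cinner_smult_left mult.assoc)
    also have "\<dots> = \<omega> s t * (\<omega> r (s * t) * cinner H (f (r * (s * t))) (V r x))"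
      by (simp add: cocycle mult_ac)
    finally show ?thesis using f x by (simp add: thread_cinner cinner_smult_left)
  qed
  show "hnorm H (\<omega> s t \<odot> f (s * t)) \<le> hnorm K f" for s
    using f by (simp add: hnorm_smult hnorm_le_hnorm_dilation)
qed (use f in simp)

text \<open>The phases of the two arguments cancel, and right translation of the index does not
  change a limit along \<open>ore_filter\<close>.\<close>

lemma cinner_dilation_op [simp]:
  assumes f: "f \<in> threads" and g: "g \<in> threads"
  shows "cinner K (dilation_op t f) (dilation_op t g) = cinner K f g"
proof (rule cinner_dilation_eqI)
  have "((\<lambda>s. cinner H (f (s * t)) (g (s * t))) \<longlongrightarrow> cinner K f g) ore_filter"
    using filterlim_compose[OF cinner_dilation_tendsto[OF f g] filterlim_mult_right_ore] .
  then show "((\<lambda>s. cinner H (dilation_op t f s) (dilation_op t g s)) \<longlongrightarrow> cinner K f g) ore_filter"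
    using f g by (simp add: dilation_op_def cinner_smult_left cinner_smult_right)
qed (use f g in simp_all)

lemma isometric_rep_dilation: "isometric_rep K \<omega> dilation_op"
  unfolding isometric_rep_def isometry_op_def linear_op_def
proof (intro conjI allI ballI)
  show "dilation_op t \<in> carrier K \<rightarrow> carrier K" for t by auto
  show "dilation_op t (f \<oplus>\<^bsub>K\<^esub> g) = dilation_op t f \<oplus>\<^bsub>K\<^esub> dilation_op t g"
    if "f \<in> carrier K" "g \<in> carrier K" for t f g
    using that by (simp add: dilation_op_def smult_add)
  show "dilation_op t (c \<odot>\<^bsub>K\<^esub> f) = c \<odot>\<^bsub>K\<^esub> dilation_op t f" if "f \<in> carrier K" for t c f
    using that by (simp add: dilation_op_def smult_smult mult.commute)
  show "hnorm K (dilation_op t f) = hnorm K f" if "f \<in> carrier K" for t f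
    using that by (simp add: hnorm_def)
  show "dilation_op s (dilation_op t f) = \<omega> s t \<odot>\<^bsub>K\<^esub> dilation_op (s * t) f"
    if "f \<in> carrier K" for s t f
    using that by (auto simp: dilation_op_def smult_smult cocycle mult.assoc mult.commute)
qed

text \<open>A preimage \<open>g\<close> of \<open>f\<close> is forced to be \<open>g (q t) = cnj (\<omega> q t) f q\<close> on the left ideal \<open>S t\<close>, and
  the thread equation then gives \<open>g u = \<omega> r u (V r)\<^sup>* g (r u)\<close> whenever \<open>r u = q t\<close>. Below, \<open>E u r q x\<close>
  is the resulting value of the inner product of \<open>g u\<close> with \<open>x\<close>.\<close>

lemma dilation_op_surj:
  assumes f: "f \<in> threads" shows "\<exists>g\<in>threads. dilation_op t g = f"
proof -
  define E where "E u r q x = \<omega> r u * cnj (\<omega> q t) * cinner H (f q) (V r x)" for u r q x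
  \<comment> \<open>By the cocycle identity the phases produced by \<open>a\<close> are
    \<open>\<omega> a (r * u)\<close> and the conjugate of \<open>\<omega> a (q * t)\<close>, which
    cancel since \<open>r * u = q * t\<close>.\<close>
  have E_mult: "E u (a * r) (a * q) x = E u r q x" if rq: "r * u = q * t" and x: "x \<in> carrier H"
    for u a r q x
  proof -
    have "E u (a * r) (a * q) x
        = (\<omega> a r * \<omega> (a * r) u) * cnj (\<omega> a q * \<omega> (a * q) t) * cinner H (f q) (V r x)"
      by (simp add: E_def thread_cinner_mult[OF f x])
    also have "\<dots> = \<omega> a (r * u) * cnj (\<omega> a (q * t)) * E u r q x"
      by (simp only: cocycle) (simp add: E_def)
    finally show ?thesis by (simp add: rq)
  qed
  \<comment> \<open>Two solutions are compared through a common multiple of \<open>r\<close> and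
    \<open>r'\<close>; right cancellation of \<open>t\<close> shows that the same factors also match
    \<open>q\<close> with \<open>q'\<close>.\<close>
  have E_indep: "E u r q x = E u r' q' x"
    if rq: "r * u = q * t" and rq': "r' * u = q' * t" and x: "x \<in> carrier H" for u r q r' q' x
  proof -
    obtain a b where ab: "a * r = b * r'" by (rule ore_common_multiple)
    then have "(a * q) * t = (b * q') * t" using rq rq' by (metis mult.assoc)
    then have "a * q = b * q'" by (rule ore_right_cancel)
    then show ?thesis using E_mult[OF rq x, of a] E_mult[OF rq' x, of b] ab by simp
  qed
  have "\<exists>y\<in>carrier H. hnorm H y \<le> hnorm K f \<and>
      (\<forall>r q. \<forall>x\<in>carrier H. r * u = q * t \<longrightarrow> cinner H y x = E u r q x)" for u
  proof -
    obtain r q where rq: "r * u = q * t" by (rule ore_common_multiple)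
    define w where "w = (\<omega> r u * cnj (\<omega> q t)) \<odot> f q"
    have w: "w \<in> carrier H" and hw: "hnorm H w \<le> hnorm K f"
      using f by (simp_all add: w_def hnorm_smult norm_mult hnorm_le_hnorm_dilation)
    \<comment> \<open>Riesz representation supplies the value at \<open>w\<close> of the adjoint of
      \<open>V r\<close>.\<close>
    have "\<exists>y\<in>carrier H. \<forall>x\<in>carrier H. cinner H (V r x) w = cinner H x y"
    proof (rule Riesz_representation)
      show "norm (cinner H (V r x) w) \<le> hnorm H w * hnorm H x" if "x \<in> carrier H" for x
        using Cauchy_Schwarz[of "V r x" w] that w by (simp add: mult.commute)
    qed (use w in \<open>auto simp: V_add V_smult cinner_add_left cinner_smult_left\<close>)
    then obtain y where y: "y \<in> carrier H"
      and eq: "\<And>x. x \<in> carrier H \<Longrightarrow> cinner H (V r x) w = cinner H x y" by blast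
    have yE: "cinner H y x = E u r q x" if x: "x \<in> carrier H" for x
    proof -
      have "cinner H y x = cinner H w (V r x)"
        using cinner_commute[OF y x] cinner_commute[of w "V r x"] eq[OF x] w x by simp
      then show ?thesis using f x by (simp add: w_def E_def cinner_smult_left)
    qed
    have "hnorm H y \<le> hnorm H w"
    proof (cases "hnorm H y = 0")
      case False
      have "(hnorm H y)\<^sup>2 = Re (cinner H (V r y) w)" using y by (simp add: hnorm_sq eq)
      also have "\<dots> \<le> hnorm H y * hnorm H w"
        using Cauchy_Schwarz[of "V r y" w] y w complex_Re_le_cmod[of "cinner H (V r y) w"] by simp
      finally show ?thesis using False hnorm_ge_zero[OF y] by (simp add: power2_eq_square)
    qed (use w hnorm_ge_zero in simp)
    with hw have "hnorm H y \<le> hnorm K f" by (rule order_trans[rotated])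
    moreover have "cinner H y x = E u r' q' x" if "r' * u = q' * t" "x \<in> carrier H" for r' q' x
      using yE[OF that(2)] E_indep[OF rq that] by simp
    ultimately show ?thesis using y by blast
  qed
  then obtain g where g: "\<And>u. g u \<in> carrier H" and bound: "\<And>u. hnorm H (g u) \<le> hnorm K f"
    and gE: "\<And>u r q x. x \<in> carrier H \<Longrightarrow> r * u = q * t \<Longrightarrow> cinner H (g u) x = E u r q x"
    by metis
  have "g \<in> threads"
  proof (rule threadsI[OF g _ bound])
    fix p u x assume x: "x \<in> carrier H"
    \<comment> \<open>One choice serves both coordinates: the pair \<open>r\<close>,
      \<open>q\<close> for \<open>p * u\<close> gives the pair \<open>r * p\<close>,
      \<open>q\<close> for \<open>u\<close>.\<close>
    obtain r q where rq: "r * (p * u) = q * t" by (rule ore_common_multiple)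
    have "\<omega> p u * cinner H (g (p * u)) (V p x)
        = \<omega> p u * (\<omega> r (p * u) * cnj (\<omega> q t) * cinner H (f q) (\<omega> r p \<odot> V (r * p) x))"
      using x by (simp add: gE[OF _ rq] E_def V_V)
    also have "\<dots> = (\<omega> r (p * u) * \<omega> p u) * cnj (\<omega> r p) * cnj (\<omega> q t) * cinner H (f q) (V (r * p) x)"
      using f x by (simp add: cinner_smult_right mult_ac)
    also have "\<dots> = (\<omega> r p * cnj (\<omega> r p)) * E u (r * p) q x"
      unfolding cocycle[symmetric] E_def by (simp only: mult_ac)
    also have "\<dots> = cinner H (g u) x"
      using x gE[of x "r * p" u q] rq by (simp add: mult.assoc)
    finally show "\<omega> p u * cinner H (g (p * u)) (V p x) = cinner H (g u) x" .
  qed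
  moreover have "dilation_op t g = f"
  proof
    fix s
    show "dilation_op t g s = f s"
    proof (rule cinner_eqI)
      fix x assume x: "x \<in> carrier H"
      \<comment> \<open>The semigroup need not have an identity, so
        \<open>r * (s * t) = q * t\<close> is solved by \<open>r = s\<close> and
        \<open>q = s * s\<close>.\<close>
      have "cinner H (dilation_op t g s) x = \<omega> s t * E (s * t) s (s * s) x"
        using g x gE[of x s "s * t" "s * s"]
        by (simp add: dilation_op_def cinner_smult_left mult.assoc)
      also have "\<dots> = (\<omega> s (s * t) * \<omega> s t) * cnj (\<omega> (s * s) t) * cinner H (f (s * s)) (V s x)"
        by (simp add: E_def mult_ac)
      also have "\<dots> = (\<omega> (s * s) t * cnj (\<omega> (s * s) t)) * (\<omega> s s * cinner H (f (s * s)) (V s x))"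
        unfolding cocycle[symmetric] by (simp only: mult_ac)
      also have "\<dots> = cinner H (f s) x" using f x by (simp add: thread_cinner)
      finally show "cinner H (dilation_op t g s) x = cinner H (f s) x" .
    qed (use f g in \<open>simp_all add: dilation_op_def\<close>)
  qed
  ultimately show ?thesis by blast
qed

text \<open>Preservation of inner products determines the adjoint on the range, which is the whole
  space by \<open>dilation_op_surj\<close>; the adjoint is therefore the inverse.\<close>

lemma adjoint_dilation_op:
  assumes f: "f \<in> threads" shows "adjoint_op K (dilation_op t) (dilation_op t f) = f"
  using f by (intro K.adjoint_op_eqI) simp_all

lemma unitary_rep_dilation: "unitary_rep K \<omega> dilation_op"
  unfolding unitary_rep_def
proof (intro conjI allI)
  fix t
  have "isometry_op K K (dilation_op t)"
    using isometric_rep_dilation by (simp add: isometric_rep_def)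
  then have "bounded_op K K (dilation_op t)"
    unfolding isometry_op_def bounded_op_def by (metis mult_1 order_refl)
  moreover have "dilation_op t (adjoint_op K (dilation_op t) f) = f" if f: "f \<in> threads" for f
    using dilation_op_surj[OF f, of t] adjoint_dilation_op by auto
  ultimately show "unitary_op K (dilation_op t)"
    by (simp add: unitary_op_def adjoint_dilation_op)
qed (rule isometric_rep_dilation)

section \<open>The embedded copy of \<open>H\<close> and density\<close>

lemma dilation_op_embed: "h \<in> carrier H \<Longrightarrow> dilation_op t (dilation_embed h) = dilation_embed (V t h)"
  by (simp add: dilation_op_def dilation_embed_def V_V)

lemma cinner_dilation_embed:
  "h \<in> carrier H \<Longrightarrow> k \<in> carrier H \<Longrightarrow>
    cinner K (dilation_embed h) (dilation_embed k) = cinner H h k"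
  by (intro cinner_dilation_eqI dilation_embed_closed) (simp_all add: dilation_embed_def)

lemma isometry_embed: "isometry_op H K dilation_embed"
  unfolding isometry_op_def linear_op_def
proof (intro conjI allI ballI)
  show "dilation_embed \<in> carrier H \<rightarrow> carrier K" by auto
  show "hnorm K (dilation_embed h) = hnorm H h" if "h \<in> carrier H" for h
    using that by (simp add: hnorm_def cinner_dilation_embed)
qed (simp_all add: dilation_embed_def V_add V_smult)

text \<open>Because the embedding preserves distances, a convergent sequence in its image comes from
  a Cauchy sequence in \<open>H\<close>. Completeness of \<open>H\<close> and uniqueness of limits
  place the limit in the image.\<close>

lemma closedin_embed: "closedin K.mtopology (dilation_embed ` carrier H)"
  unfolding K.metric_closedin_iff_sequentially_closed
proof (intro conjI allI impI)
  show "dilation_embed ` carrier H \<subseteq> carrier K" by auto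
  fix \<sigma> f
  assume \<sigma>: "range \<sigma> \<subseteq> dilation_embed ` carrier H \<and> limitin K.mtopology \<sigma> f sequentially"
  then have "\<forall>n. \<exists>h\<in>carrier H. \<sigma> n = dilation_embed h" by (auto simp: image_subset_iff)
  then obtain h where h: "\<And>n. h n \<in> carrier H" and \<sigma>h: "\<And>n. \<sigma> n = dilation_embed (h n)" by metis
  have dist: "hdist K (dilation_embed x) (dilation_embed y) = hdist H x y" if "x \<in> carrier H" "y \<in> carrier H" for x y
  proof -
    have "dilation_embed x \<ominus>\<^bsub>K\<^esub> dilation_embed y = dilation_embed (x \<ominus> y)"
    proof
      fix s
      have "V s x = V s (x \<ominus> y) \<oplus> V s y"
        using that by (simp add: V_add[symmetric] a_minus_def M.a_assoc M.l_neg)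
      then have "V s x \<ominus> V s y = V s (x \<ominus> y)"
        using that by (simp add: a_minus_def M.a_assoc M.r_neg)
      then show "(dilation_embed x \<ominus>\<^bsub>K\<^esub> dilation_embed y) s = dilation_embed (x \<ominus> y) s"
        using that by (simp add: diff_dilation) (simp add: dilation_embed_def)
    qed
    then show ?thesis
      using that isometry_embed by (simp add: hdist_def isometry_op_def)
  qed
  have "K.MCauchy \<sigma>" using \<sigma> by (intro K.convergent_imp_MCauchy) auto
  then have "MCauchy h"
    unfolding K.MCauchy_def MCauchy_def using h dist by (auto simp: \<sigma>h)
  then obtain x where "limitin mtopology h x sequentially"
    using complete by (auto simp: mcomplete_def)
  then have x: "x \<in> carrier H" and "(\<lambda>n. hdist H (h n) x) \<longlonglongrightarrow> 0"
    by (auto simp: limitin_metric_dist_null)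
  then have "limitin K.mtopology \<sigma> (dilation_embed x) sequentially"
    unfolding K.limitin_metric_dist_null using h by (simp add: \<sigma>h dist)
  then have "f = dilation_embed x" using \<sigma> K.limitin_metric_unique by (metis sequentially_bot)
  then show "f \<in> dilation_embed ` carrier H" using x by blast
qed

text \<open>By the thread equation the inner products are constant in \<open>r\<close>. Thus
  \<open>f s\<close> represents the orthogonal projection of \<open>dilation_op s f\<close> onto the
  embedded \<open>H\<close>.\<close>

lemma cinner_dilation_op_embed:
  assumes f: "f \<in> threads" and h: "h \<in> carrier H"
  shows "cinner K (dilation_op s f) (dilation_embed h) = cinner H (f s) h"
proof (rule cinner_dilation_eqI)
  show "((\<lambda>r. cinner H (dilation_op s f r) (dilation_embed h r)) \<longlongrightarrow> cinner H (f s) h) ore_filter"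
    using f h by (simp add: dilation_op_def dilation_embed_def cinner_smult_left thread_cinner)
qed (use f h in simp_all)

lemma dense_adjoint_embed:
  "K.mtopology closure_of (\<Union>s. adjoint_op K (dilation_op s) ` (dilation_embed ` carrier H)) = carrier K"
proof -
  have "\<exists>g\<in>\<Union>s. adjoint_op K (dilation_op s) ` (dilation_embed ` carrier H). g \<in> K.mball f e"
    if f: "f \<in> threads" and e: "e > 0" for f e
  proof -
    have "Re (cinner K f f) - e\<^sup>2 < Re (cinner K f f)" using e by simp
    from order_tendstoD(1)[OF hnorm_dilation_tendsto[OF f] this]
    obtain s where s: "Re (cinner K f f) - e\<^sup>2 < (hnorm H (f s))\<^sup>2"
      using eventually_happens'[OF ore_filter_neq_bot] by blast
    obtain g where g: "g \<in> threads" and gs: "dilation_op s g = dilation_embed (f s)"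
      using dilation_op_surj[of "dilation_embed (f s)" s] f by auto
    have ga: "g = adjoint_op K (dilation_op s) (dilation_embed (f s))"
      using adjoint_dilation_op[OF g, of s] gs by simp
    have gg: "cinner K g g = cinner H (f s) (f s)"
      using cinner_dilation_op[OF g g, of s] f by (simp add: gs cinner_dilation_embed)
    \<comment> \<open>As this equals \<open>cinner K g g\<close>, the difference of \<open>f\<close>
      and \<open>g\<close> is orthogonal to \<open>g\<close>, and Pythagoras gives the squared
      distance.\<close>
    have fg: "cinner K f g = cinner H (f s) (f s)"
      using cinner_dilation_op[OF f g, of s] f by (simp add: gs cinner_dilation_op_embed)
    have "(hdist K f g)\<^sup>2 = Re (cinner K f f) - (hnorm H (f s))\<^sup>2"
      using f g K.hnorm_diff_sq[of f g] by (simp add: hdist_def K.hnorm_sq hnorm_sq gg fg)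
    also have "\<dots> < e\<^sup>2" using s by simp
    finally have "hdist K f g < e" using e by (simp add: power_less_imp_less_base)
    then have "g \<in> K.mball f e" using f g unfolding K.in_mball by simp
    moreover have "g \<in> adjoint_op K (dilation_op s) ` (dilation_embed ` carrier H)"
      unfolding ga by (intro imageI) (simp add: f)
    ultimately show ?thesis by (intro bexI[of _ g] UN_I[of s] UNIV_I)
  qed
  then show ?thesis unfolding K.metric_closure_of by auto
qed

end

theorem theorem1p2p1:
  fixes H :: "'a cinner_space"
    and \<omega> :: "'s::ore_semigroup \<Rightarrow> 's \<Rightarrow> complex"
    and V :: "'s \<Rightarrow> 'a \<Rightarrow> 'a"
  assumes "complex_hilbert_space H"
    and "circle_multiplier \<omega>"
    and "isometric_rep H \<omega> V"
  shows "\<exists>(K :: ('s \<Rightarrow> 'a) cinner_space) (U :: 's \<Rightarrow> ('s \<Rightarrow> 'a) \<Rightarrow> ('s \<Rightarrow> 'a)) (J :: 'a \<Rightarrow> ('s \<Rightarrow> 'a)).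
           complex_hilbert_space K \<and>
           unitary_rep K \<omega> U \<and>
           isometry_op H K J \<and>
           closedin (Metric_space.mtopology (carrier K) (hdist K)) (J ` carrier H) \<and>
           (\<forall>s. U s ` (J ` carrier H) \<subseteq> J ` carrier H \<and>
                (\<forall>h\<in>carrier H. U s (J h) = J (V s h))) \<and>
           Metric_space.mtopology (carrier K) (hdist K) closure_of
             (\<Union>s. adjoint_op K (U s) ` (J ` carrier H)) = carrier K"
proof -
  interpret isometric_ore_rep H \<omega> V
    using assms by (intro isometric_ore_rep.intro isometric_ore_rep_axioms.intro)
  have "dilation_op s ` (dilation_embed ` carrier H) \<subseteq> dilation_embed ` carrier H" for s
    by (auto simp: dilation_op_embed)
  then show ?thesis
    using complex_hilbert_space_dilation unitary_rep_dilation isometry_embed closedin_embed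
      dilation_op_embed dense_adjoint_embed
    by (intro exI[of _ dilation] exI[of _ dilation_op] exI[of _ dilation_embed] conjI allI ballI)
qed

end
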